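(* Let $f:\mathbb{R}^n\to\mathbb{R}^n$ be continuously differentiable and $q:\mathbb{R}^n\to\mathbb{R}\cup\{+\infty\}$ proper, convex and lower semicontinuous. Let $\hat x\in\mathbb{R}^n$, $(\hat d,\hat d^* )\in\mathrm{gph}\,\partial q$, and let $G$ be a symmetric positive semidefinite $n\times n$ matrix with $\|G\|\le1$ such that $Gv^*\in D^*(\partial q)(\hat d,\hat d^* )((I-G)v^* )$ for all $v^*\in\mathbb{R}^n$. Assume that \[0\in\nabla f(\hat x)^Ts+D^*(\partial q)(\hat d,\hat d^* )(s)\ \Longrightarrow\ s=0.\] Then the matrix $(I-G)\nabla f(\hat x)+G$ is nonsingular and \[\|((I-G)\nabla f(\hat x)+G)^{-1}\|\le 1+\frac1\mu\|\nabla f(\hat x)-I\|,\qquad\text{where } \mu=\min_{\|s\|=1}\operatorname{dist}\bigl(0,\nabla f(\hat x)^Ts+D^*(\partial q)(\hat d,\hat d^* )(s)\bigr).\]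
   Context: $\partial q$ is the convex subdifferential, $\nabla f(\hat x)$ the Jacobian, norms are Euclidean/spectral. For a closed set $C$ and $\bar z\in C$: the regular normal cone $\widehat N_C(\bar z)$ is the polar of the tangent cone $T_C(\bar z)=\{w:\exists t_k\downarrow0,w_k\to w,\ \bar z+t_kw_k\in C\}$; the limiting normal cone $N_C(\bar z)$ consists of all limits of $z_k^*\in\widehat N_C(z_k)$ with $z_k\in C$, $z_k\to\bar z$. For a set-valued map $F$ with $(\bar x,\bar y)\in\mathrm{gph}\, F$, the limiting coderivative is $D^*F(\bar x,\bar y)(v^* )=\{u^*:(u^*,-v^* )\in N_{\mathrm{gph}\, F}(\bar x,\bar y)\}$. *)

theory Defs
  imports "HOL-Analysis.Analysis"
begin

text \<open>Extended-real valued functions q : R^n -> R \<union> {+\<infinity>}, modelled with ereal values.\<close>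

definition proper_fun :: "('a \<Rightarrow> ereal) \<Rightarrow> bool" where
  "proper_fun q \<longleftrightarrow> (\<forall>x. q x \<noteq> -\<infinity>) \<and> (\<exists>x. q x \<noteq> \<infinity>)"

text \<open>Convexity of an extended-real valued function: convex epigraph.\<close>
definition convex_fun :: "('a::real_vector \<Rightarrow> ereal) \<Rightarrow> bool" where
  "convex_fun q \<longleftrightarrow> convex {(x, t::real). q x \<le> ereal t}"

definition lsc_fun :: "('a::topological_space \<Rightarrow> ereal) \<Rightarrow> bool" where
  "lsc_fun q \<longleftrightarrow> (\<forall>x. q x \<le> Liminf (at x) q)"

text \<open>Convex subdifferential (empty outside the effective domain).\<close>
definition subdiff :: "('a::real_inner \<Rightarrow> ereal) \<Rightarrow> 'a \<Rightarrow> 'a set" where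
  "subdiff q x = {v. \<bar>q x\<bar> \<noteq> \<infinity> \<and> (\<forall>y. q x + ereal (v \<bullet> (y - x)) \<le> q y)}"

definition graph_of :: "('a \<Rightarrow> 'b set) \<Rightarrow> ('a \<times> 'b) set" where
  "graph_of F = {(x, y). y \<in> F x}"

definition tangent_cone :: "'a::real_normed_vector set \<Rightarrow> 'a \<Rightarrow> 'a set" where
  "tangent_cone C z = {w. \<exists>t ws. (\<forall>k. t k > (0::real)) \<and> t \<longlonglongrightarrow> 0 \<and> ws \<longlonglongrightarrow> w
        \<and> (\<forall>k. z + t k *\<^sub>R ws k \<in> C)}"

text \<open>Regular normal cone: polar of the tangent cone (only at points of C).\<close>
definition regular_normal_cone :: "'a::real_inner set \<Rightarrow> 'a \<Rightarrow> 'a set" where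
  "regular_normal_cone C z = {v. z \<in> C \<and> (\<forall>w\<in>tangent_cone C z. v \<bullet> w \<le> 0)}"

definition limiting_normal_cone :: "'a::real_inner set \<Rightarrow> 'a \<Rightarrow> 'a set" where
  "limiting_normal_cone C z = {v. z \<in> C \<and> (\<exists>zs vs. (\<forall>k. zs k \<in> C \<and> vs k \<in> regular_normal_cone C (zs k))
        \<and> zs \<longlonglongrightarrow> z \<and> vs \<longlonglongrightarrow> v)}"

text \<open>Limiting coderivative D*F(x,y)(v).\<close>
definition coderivative :: "('a::real_inner \<Rightarrow> 'b::real_inner set) \<Rightarrow> 'a \<Rightarrow> 'b \<Rightarrow> 'b \<Rightarrow> 'a set" where
  "coderivative F x y v = {u. (u, -v) \<in> limiting_normal_cone (graph_of F) (x, y)}"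

text \<open>Distance from 0 to a set, with the convention dist(0, {}) = +\<infinity>.\<close>
definition dist0 :: "'a::real_normed_vector set \<Rightarrow> ereal" where
  "dist0 S = (INF u\<in>S. ereal (norm u))"

end

theory Submission
  imports Defs
begin

text \<open>Put \<open>A = \<nabla>f(x)\<close>, \<open>T = ((I - G) A + G)\<^sup>T = A\<^sup>T (I - G) + G\<close> and, for a vector \<open>v\<close>,
  \<open>s = (I - G) v\<close>. Then \<open>v = s + G v\<close> and \<open>T v = A\<^sup>T s + G v\<close> with \<open>G v \<in> D\<^sup>*(\<partial>q)(s)\<close>.
  Writing \<open>v = T v - (A\<^sup>T - I) s\<close> gives \<open>|v| \<le> |T v| + \<parallel>A - I\<parallel> |s|\<close>, and positive
  homogeneity of the coderivative gives \<open>\<mu> |s| \<le> |T v|\<close>; hence \<open>|v| \<le> (1 + \<parallel>A - I\<parallel>/\<mu>) |T v|\<close>.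
  The regularity condition makes \<open>T\<close> injective (\<open>T v = 0\<close> forces \<open>s = 0\<close>), and the bound on
  \<open>T\<^sup>-\<^sup>1\<close> is the bound on its transpose \<open>((I - G) A + G)\<^sup>-\<^sup>1\<close>.\<close>

lemma transpose_add: "transpose (A + B) = transpose A + transpose (B::'a::semiring_1^'n^'m)"
  by (simp add: transpose_def vec_eq_iff)

lemma transpose_diff: "transpose (A - B) = transpose A - transpose (B::'a::ring_1^'n^'m)"
  by (simp add: transpose_def vec_eq_iff)

lemma norm_transpose_mult_le:
  fixes X :: "real^'n^'m"
  shows "norm (transpose X *v y) \<le> onorm ((*v) X) * norm y"
proof -
  define z where "z = transpose X *v y"
  have "norm z * norm z = y \<bullet> (X *v z)"
    unfolding z_def transpose_matrix_vector
    by (simp add: dot_lmul_matrix inner_commute flip: dot_square_norm power2_eq_square)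
  also have "\<dots> \<le> norm y * norm (X *v z)"
    by (rule norm_cauchy_schwarz)
  also have "\<dots> \<le> norm y * (onorm ((*v) X) * norm z)"
    by (simp add: onorm mult_left_mono)
  finally have "norm z * norm z \<le> (onorm ((*v) X) * norm y) * norm z"
    by (simp add: algebra_simps)
  then show ?thesis
    by (cases "z = 0") (simp_all add: z_def onorm_pos_le)
qed

lemma onorm_transpose: "onorm ((*v) (transpose X)) = onorm ((*v) (X::real^'n^'m))"
  by (metis antisym onorm_le norm_transpose_mult_le transpose_transpose)

lemma onorm_matrix_inv_le:
  fixes M :: "real^'n^'n"
  assumes "invertible M" and "\<And>v. norm v \<le> K * norm (transpose M *v v)"
  shows "onorm ((*v) (matrix_inv M)) \<le> K"
proof -
  have "M ** matrix_inv M = mat 1 \<and> matrix_inv M ** M = mat 1"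
    using assms(1) unfolding invertible_def matrix_inv_def by (rule someI_ex)
  then have right_inverse: "transpose M ** transpose (matrix_inv M) = mat 1"
    by (metis matrix_transpose_mul transpose_mat)
  have "norm (transpose (matrix_inv M) *v w) \<le> K * norm w" for w
    using assms(2)[of "transpose (matrix_inv M) *v w"]
    by (simp only: matrix_vector_mul_assoc right_inverse matrix_vector_mul_lid)
  then have "onorm ((*v) (transpose (matrix_inv M))) \<le> K"
    by (rule onorm_le)
  then show ?thesis
    by (simp add: onorm_transpose)
qed

lemma regular_normal_cone_scaleR:
  assumes "v \<in> regular_normal_cone C z" "0 \<le> t"
  shows "t *\<^sub>R v \<in> regular_normal_cone C z"
  using assms unfolding regular_normal_cone_def by (auto simp: mult_nonneg_nonpos)

lemma limiting_normal_cone_scaleR: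
  assumes "v \<in> limiting_normal_cone C z" "0 \<le> t"
  shows "t *\<^sub>R v \<in> limiting_normal_cone C z"
proof -
  obtain zs vs where "z \<in> C" and approx: "\<forall>k. zs k \<in> C \<and> vs k \<in> regular_normal_cone C (zs k)"
    and "zs \<longlonglongrightarrow> z" "vs \<longlonglongrightarrow> v"
    using assms(1) unfolding limiting_normal_cone_def by blast
  have "\<forall>k. zs k \<in> C \<and> t *\<^sub>R vs k \<in> regular_normal_cone C (zs k)"
    using approx assms(2) regular_normal_cone_scaleR by blast
  moreover have "(\<lambda>k. t *\<^sub>R vs k) \<longlonglongrightarrow> t *\<^sub>R v"
    using \<open>vs \<longlonglongrightarrow> v\<close> by (intro tendsto_intros)
  ultimately show ?thesis
    using \<open>z \<in> C\<close> \<open>zs \<longlonglongrightarrow> z\<close> unfolding limiting_normal_cone_def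
    by (intro CollectI conjI exI[of _ zs] exI[of _ "\<lambda>k. t *\<^sub>R vs k"])
qed

lemma coderivative_scaleR:
  assumes "u \<in> coderivative F x y v" "0 \<le> t"
  shows "t *\<^sub>R u \<in> coderivative F x y (t *\<^sub>R v)"
  using limiting_normal_cone_scaleR[of "(u, -v)" _ _ t] assms
  unfolding coderivative_def by simp

definition regularity_modulus ::
    "('b \<Rightarrow> 'a) \<Rightarrow> ('a::real_inner \<Rightarrow> 'b::real_inner set) \<Rightarrow> 'a \<Rightarrow> 'b \<Rightarrow> ereal" where
  "regularity_modulus L F x y = (INF s\<in>{s. norm s = 1}. dist0 ((\<lambda>u. L s + u) ` coderivative F x y s))"

lemma regularity_modulus_nonneg: "0 \<le> regularity_modulus L F x y"
  unfolding regularity_modulus_def dist0_def by (intro INF_greatest) simp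

lemma norm_mult_regularity_modulus_le:
  assumes "linear L" "u \<in> coderivative F x y s"
  shows "ereal (norm s) * regularity_modulus L F x y \<le> ereal (norm (L s + u))"
proof (cases "s = 0")
  case False
  define t where "t = 1 / norm s"
  have "t *\<^sub>R u \<in> coderivative F x y (t *\<^sub>R s)"
    using assms(2) by (rule coderivative_scaleR) (simp add: t_def)
  then have "L (t *\<^sub>R s) + t *\<^sub>R u \<in> (\<lambda>u. L (t *\<^sub>R s) + u) ` coderivative F x y (t *\<^sub>R s)"
    by (rule imageI)
  then have "regularity_modulus L F x y \<le> ereal (norm (L (t *\<^sub>R s) + t *\<^sub>R u))"
    unfolding regularity_modulus_def dist0_def using False
    by (intro INF_lower2[of "t *\<^sub>R s"] INF_lower) (simp_all add: t_def)
  also have "\<dots> = ereal (norm (L s + u) / norm s)"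
    using assms(1) by (simp add: t_def linear_scale flip: scaleR_add_right)
  finally have "ereal (norm s) * regularity_modulus L F x y
      \<le> ereal (norm s) * ereal (norm (L s + u) / norm s)"
    by (rule ereal_mult_left_mono) simp
  then show ?thesis
    using False by simp
qed (simp add: zero_ereal_def[symmetric])

text \<open>In \<open>ereal\<close>, \<open>c / 0 = \<infinity>\<close> for \<open>c > 0\<close> and \<open>0 * \<infinity> = 0\<close>: a finite \<open>K\<close> arises only
  from a positive real \<open>mu\<close>, from \<open>c = 0\<close> (\<open>K = 1\<close>), or from \<open>mu = \<infinity>\<close> (\<open>K = 1\<close>, and the
  first hypothesis forces \<open>s = 0\<close>).\<close>

lemma add_mult_le_of_ereal_div_bound:
  fixes b c s K :: real and mu :: ereal
  assumes "ereal s * mu \<le> ereal b" and "1 + ereal c / mu = ereal K"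
    and "0 \<le> c" "0 \<le> s" "0 \<le> mu"
  shows "b + c * s \<le> K * b"
proof (cases mu)
  case (real r)
  show ?thesis
  proof (cases "r = 0")
    case True
    then have "c = 0 \<and> K = 1"
      using assms(2,3) real by (cases "c = 0") (auto simp: zero_ereal_def)
    then show ?thesis by simp
  next
    case False
    have "0 < r" "s * r \<le> b" and K: "K = 1 + c / r"
      using assms real False by auto
    then have "s \<le> b / r"
      by (simp add: field_simps)
    then have "c * s \<le> c * (b / r)"
      using assms(3) by (rule mult_left_mono)
    then show ?thesis
      unfolding K by (simp add: algebra_simps)
  qed
next
  case PInf
  then have "s = 0" "K = 1"
    using assms by (auto split: if_splits)
  then show ?thesis by simp
qed (use assms in simp)

lemma transpose_splitting_mult:
  fixes A G :: "real^'n^'n"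
  assumes "transpose G = G"
  shows "transpose ((mat 1 - G) ** A + G) *v v = transpose A *v ((mat 1 - G) *v v) + G *v v"
  by (simp add: assms transpose_add transpose_diff matrix_transpose_mul matrix_vector_mul_assoc
      matrix_vector_mult_add_rdistrib del: transpose_matrix_vector)

lemma norm_le_transpose_splitting:
  fixes A G :: "real^'n^'n"
  assumes "transpose G = G"
  shows "norm v \<le> norm (transpose ((mat 1 - G) ** A + G) *v v)
    + onorm ((*v) (A - mat 1)) * norm ((mat 1 - G) *v v)"
proof -
  define s where "s = (mat 1 - G) *v v"
  have "v = transpose ((mat 1 - G) ** A + G) *v v - transpose (A - mat 1) *v s"
    unfolding transpose_splitting_mult[OF assms] s_def
    by (simp add: transpose_diff matrix_vector_mult_diff_rdistrib del: transpose_matrix_vector)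
  then have "norm v \<le> norm (transpose ((mat 1 - G) ** A + G) *v v) + norm (transpose (A - mat 1) *v s)"
    by (metis norm_triangle_ineq4)
  then show ?thesis
    using norm_transpose_mult_le[of "A - mat 1" s] unfolding s_def by linarith
qed

lemma invertible_and_onorm_matrix_inv_le:
  fixes M :: "real^'n^'n" and s :: "real^'n \<Rightarrow> 'a::real_normed_vector"
  assumes split: "\<And>v. norm v \<le> norm (transpose M *v v) + c * norm (s v)"
    and modulus: "\<And>v. ereal (norm (s v)) * mu \<le> ereal (norm (transpose M *v v))"
    and kernel: "\<And>v. transpose M *v v = 0 \<Longrightarrow> s v = 0"
    and "0 \<le> c" "0 \<le> mu"
  shows "invertible M \<and> ereal (onorm ((*v) (matrix_inv M))) \<le> 1 + ereal c / mu"
proof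
  have "v = 0" if "transpose M *v v = 0" for v
    using split[of v] kernel[OF that] that by simp
  then have "invertible (transpose M)"
    unfolding invertible_left_inverse matrix_left_invertible_ker by blast
  then show "invertible M"
    using transpose_invertible by fastforce
  show "ereal (onorm ((*v) (matrix_inv M))) \<le> 1 + ereal c / mu"
  proof (cases "1 + ereal c / mu")
    case (real K)
    have "norm v \<le> K * norm (transpose M *v v)" for v
      using split[of v] add_mult_le_of_ereal_div_bound[OF modulus[of v] real] assms(4,5)
      by simp
    then have "onorm ((*v) (matrix_inv M)) \<le> K"
      using \<open>invertible M\<close> onorm_matrix_inv_le by blast
    then show ?thesis
      using real by simp
  qed (use assms(4,5) in simp_all)
qed

theorem proposition4p2:
  fixes f :: "real^'n \<Rightarrow> real^'n"
    and Df :: "real^'n \<Rightarrow> real^'n^'n"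
    and q :: "real^'n \<Rightarrow> ereal"
    and xh dh dsh :: "real^'n"
    and G :: "real^'n^'n"
  assumes deriv: "\<forall>x. (f has_derivative (\<lambda>h. Df x *v h)) (at x)"
    and cont: "continuous_on UNIV Df"
    and q_proper: "proper_fun q" and q_convex: "convex_fun q" and q_lsc: "lsc_fun q"
    and gph: "dsh \<in> subdiff q dh"
    and G_sym: "transpose G = G"
    and G_psd: "\<forall>v. 0 \<le> v \<bullet> (G *v v)"
    and G_norm: "onorm (\<lambda>v. G *v v) \<le> 1"
    and G_cod: "\<forall>v. G *v v \<in> coderivative (subdiff q) dh dsh ((mat 1 - G) *v v)"
    and reg: "\<forall>s. 0 \<in> (\<lambda>u. transpose (Df xh) *v s + u) ` coderivative (subdiff q) dh dsh s \<longrightarrow> s = 0"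
  shows "invertible ((mat 1 - G) ** Df xh + G) \<and>
    ereal (onorm (\<lambda>v. matrix_inv ((mat 1 - G) ** Df xh + G) *v v))
      \<le> 1 + ereal (onorm (\<lambda>v. (Df xh - mat 1) *v v)) /
        (INF s\<in>{s. norm s = 1}. dist0 ((\<lambda>u. transpose (Df xh) *v s + u) ` coderivative (subdiff q) dh dsh s))"
proof -
  define M where "M = (mat 1 - G) ** Df xh + G"
  define s where "s v = (mat 1 - G) *v v" for v
  have Tv: "transpose M *v v = transpose (Df xh) *v s v + G *v v" for v
    unfolding M_def s_def by (rule transpose_splitting_mult[OF G_sym])
  have "invertible M \<and> ereal (onorm ((*v) (matrix_inv M)))
      \<le> 1 + ereal (onorm ((*v) (Df xh - mat 1)))
        / regularity_modulus ((*v) (transpose (Df xh))) (subdiff q) dh dsh"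
  proof (rule invertible_and_onorm_matrix_inv_le)
    show "norm v \<le> norm (transpose M *v v) + onorm ((*v) (Df xh - mat 1)) * norm (s v)" for v
      unfolding M_def s_def by (rule norm_le_transpose_splitting[OF G_sym])
    show "ereal (norm (s v)) * regularity_modulus ((*v) (transpose (Df xh))) (subdiff q) dh dsh
        \<le> ereal (norm (transpose M *v v))" for v
      unfolding Tv using G_cod s_def by (intro norm_mult_regularity_modulus_le) auto
    show "s v = 0" if "transpose M *v v = 0" for v
      using reg G_cod that unfolding Tv s_def by (metis image_eqI)
  qed (simp_all add: onorm_pos_le regularity_modulus_nonneg)
  then show ?thesis
    unfolding M_def regularity_modulus_def by simp
qed

end
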